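(* Let $A$ be a real $m\times n$ matrix, $r$ a positive integer, $\mathcal{I}\subseteq\{1,\dots,n\}$ a fixed index set, and let $\|\cdot\|$ be any norm on $\mathbb{R}^r$. Suppose that every $X_0\in\mathbb{R}^{n\times r}$ with $\mathrm{Supp}_{\mathrm{row}}(X_0)\subseteq\mathcal{I}$ is the unique solution of $$\min_{X\in\mathbb{R}^{n\times r}}\ \sum_{j=1}^n\|X^{j\rightarrow}\|\quad\text{subject to}\quad AX=AX_0.$$ Then uniform recovery on $\mathcal{I}$ using $\ell_{1,1}$ holds, i.e. every $X_0\in\mathbb{R}^{n\times r}$ with $\mathrm{Supp}_{\mathrm{row}}(X_0)\subseteq\mathcal{I}$ is the unique solution of $$\min_{X\in\mathbb{R}^{n\times r}}\ \|X\|_{1,1}\quad\text{subject to}\quad AX=AX_0.$$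
   Context: For a matrix $X\in\mathbb{R}^{n\times r}$, $X^{j\rightarrow}\in\mathbb{R}^r$ denotes the $j$th row of $X$ regarded as a column vector. The row support $\mathrm{Supp}_{\mathrm{row}}(X)$ is the set of indices of nonzero rows of $X$. The norm $\|X\|_{1,1}=\sum_{j=1}^n\|X^{j\rightarrow}\|_1=\sum_{j,k}|X_{jk}|$ is the sum of the $\ell_1$-norms of the rows. *)

theory Defs
  imports "HOL-Analysis.Analysis"
begin

text \<open>
  An \<open>n\<close> by \<open>r\<close> real matrix has type \<open>real ^ 'r ^ 'n\<close>. The norm on \<open>\<real>\<^sup>r\<close> is an arbitrary function
  satisfying the norm axioms, since the type class constant \<^const>\<open>norm\<close> is fixed to be the
  Euclidean norm on this type.
\<close>

definition is_norm :: "('a::real_vector \<Rightarrow> real) \<Rightarrow> bool" where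
  "is_norm N \<longleftrightarrow>
     (\<forall>x. 0 \<le> N x) \<and>
     (\<forall>x. N x = 0 \<longleftrightarrow> x = 0) \<and>
     (\<forall>c x. N (c *\<^sub>R x) = \<bar>c\<bar> * N x) \<and>
     (\<forall>x y. N (x + y) \<le> N x + N y)"

definition row_support :: "real ^ 'r ^ 'n \<Rightarrow> 'n set" where
  "row_support X = {j. row j X \<noteq> 0}"

definition row_norm_sum :: "(real ^ 'r \<Rightarrow> real) \<Rightarrow> real ^ 'r ^ 'n \<Rightarrow> real" where
  "row_norm_sum N X = (\<Sum>j\<in>UNIV. N (row j X))"

definition l1_norm :: "real ^ 'r \<Rightarrow> real" where
  "l1_norm x = (\<Sum>k\<in>UNIV. \<bar>x $ k\<bar>)"

definition l11_norm :: "real ^ 'r ^ 'n \<Rightarrow> real" where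
  "l11_norm X = row_norm_sum l1_norm X"

definition unique_minimizer :: "('a \<Rightarrow> real) \<Rightarrow> ('a \<Rightarrow> bool) \<Rightarrow> 'a \<Rightarrow> bool" where
  "unique_minimizer f P x \<longleftrightarrow> is_arg_min f P x \<and> (\<forall>y. is_arg_min f P y \<longrightarrow> y = x)"

definition uniform_recovery ::
    "(real ^ 'r ^ 'n \<Rightarrow> real) \<Rightarrow> real ^ 'n ^ 'm \<Rightarrow> 'n set \<Rightarrow> bool" where
  "uniform_recovery f A I \<longleftrightarrow>
     (\<forall>X0. row_support X0 \<subseteq> I \<longrightarrow> unique_minimizer f (\<lambda>X. A ** X = A ** X0) X0)"

end

theory Submission
  imports Defs
begin

text \<open>
  Testing the hypothesis on rank-one matrices \<open>v u\<^sup>T\<close> with \<open>A v = 0\<close> cancels the factor \<open>N u\<close> and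
  leaves the scalar null space property \<open>\<Sum>j\<in>I. \<bar>v\<^sub>j\<bar> < \<Sum>j\<notin>I. \<bar>v\<^sub>j\<bar>\<close> for all nonzero \<open>v\<close> in the
  kernel of \<open>A\<close>. As the \<open>\<ell>\<^sub>1\<^sub>,\<^sub>1\<close> norm is the sum of the \<open>\<ell>\<^sub>1\<close> norms of the columns, adding up this
  inequality over the columns of a matrix \<open>V\<close> with \<open>A V = 0\<close> gives the null space property for the
  \<open>\<ell>\<^sub>1\<^sub>,\<^sub>1\<close> norm, which implies recovery.
\<close>

text \<open>A feasible \<open>y \<noteq> x\<close> with \<open>f y \<le> f x\<close> would be a
  second minimizer. This strict form serves both to exploit the hypothesis and to prove the
  conclusion.\<close>

lemma unique_minimizer_iff:
  "unique_minimizer f P x \<longleftrightarrow> P x \<and> (\<forall>y. P y \<longrightarrow> y \<noteq> x \<longrightarrow> f x < f y)"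
proof
  assume min: "unique_minimizer f P x"
  have "f x < f y" if "P y" "y \<noteq> x" for y
  proof (rule ccontr)
    assume "\<not> f x < f y"
    then have "is_arg_min f P y"
      using min \<open>P y\<close> unfolding unique_minimizer_def is_arg_min_def by (metis le_less_trans not_less)
    then show False
      using min \<open>y \<noteq> x\<close> by (simp add: unique_minimizer_def)
  qed
  then show "P x \<and> (\<forall>y. P y \<longrightarrow> y \<noteq> x \<longrightarrow> f x < f y)"
    using min by (simp add: unique_minimizer_def is_arg_min_def)
next
  assume "P x \<and> (\<forall>y. P y \<longrightarrow> y \<noteq> x \<longrightarrow> f x < f y)"
  then show "unique_minimizer f P x"
    unfolding unique_minimizer_def is_arg_min_def by (metis less_asym)
qed

lemma sum_UNIV_split:
  fixes f :: "'a::finite \<Rightarrow> 'b::comm_monoid_add"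
  shows "sum f UNIV = sum f I + sum f (- I)"
  by (metis Compl_partition Compl_disjoint finite_class.finite sum.union_disjoint)

lemma matrix_diff_ldistrib:
  fixes A :: "'a::ring_1 ^ 'n ^ 'm"
  shows "A ** (B - C) = A ** B - A ** C"
  by (simp add: vec_eq_iff matrix_matrix_mult_def right_diff_distrib sum_subtractf)

lemma scalar_null_space_property:
  fixes A :: "real ^ 'n ^ 'm" and N :: "real ^ 'r \<Rightarrow> real"
  assumes N: "is_norm N" and rec: "uniform_recovery (row_norm_sum N) A I"
    and ker: "A *v v = 0" and "v \<noteq> 0"
  shows "(\<Sum>j\<in>I. \<bar>v $ j\<bar>) < (\<Sum>j\<in>- I. \<bar>v $ j\<bar>)"
proof -
  \<comment> \<open>The all-ones vector; any nonzero vector would serve, as only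
    \<open>N u > 0\<close> and homogeneity enter.\<close>
  define u :: "real ^ 'r" where "u = 1"
  \<comment> \<open>\<open>X\<close> is the part of the rank-one matrix with rows
    \<open>v $ j *\<^sub>R u\<close> on \<open>I\<close>, and \<open>Y\<close> is minus the part off
    \<open>I\<close>. Hence \<open>X - Y\<close> is the whole matrix and \<open>A\<close>
    annihilates it, so \<open>Y\<close> competes with \<open>X\<close>.\<close>
  define X :: "real ^ 'r ^ 'n" where "X = (\<chi> j. (if j \<in> I then v $ j else 0) *\<^sub>R u)"
  define Y :: "real ^ 'r ^ 'n" where "Y = (\<chi> j. (if j \<in> I then 0 else - v $ j) *\<^sub>R u)"
  have scale: "N (c *\<^sub>R u) = \<bar>c\<bar> * N u" for c
    using N by (simp add: is_norm_def)
  have "u \<noteq> 0"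
    by (simp add: u_def)
  then have "N u > 0"
    using N unfolding is_norm_def by (metis order_le_less)
  have row: "row j Z = Z $ j" for j and Z :: "real ^ 'r ^ 'n"
    by (simp add: row_def)
  have "N 0 = 0"
    using N by (simp add: is_norm_def)
  have row_X: "N (row j X) = (if j \<in> I then \<bar>v $ j\<bar> * N u else 0)" for j
    using \<open>N 0 = 0\<close> by (simp add: row X_def scale)
  have row_Y: "N (row j Y) = (if j \<in> I then 0 else \<bar>v $ j\<bar> * N u)" for j
    using \<open>N 0 = 0\<close> scale[of "- v $ j"] by (simp add: row Y_def)
  have X: "row_norm_sum N X = (\<Sum>j\<in>I. \<bar>v $ j\<bar>) * N u"
    unfolding row_norm_sum_def sum_UNIV_split[of _ I] by (simp add: row_X sum_distrib_right)
  have Y: "row_norm_sum N Y = (\<Sum>j\<in>- I. \<bar>v $ j\<bar>) * N u"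
    unfolding row_norm_sum_def sum_UNIV_split[of _ I] by (simp add: row_Y sum_distrib_right)
  have "(A ** (X - Y)) $ i $ k = (A *v v) $ i * u $ k" for i k
    by (auto simp: matrix_matrix_mult_def matrix_vector_mult_def X_def Y_def sum_distrib_right
        intro!: sum.cong)
  then have "A ** (X - Y) = 0"
    by (simp add: ker vec_eq_iff)
  then have feas: "A ** Y = A ** X"
    by (simp add: matrix_diff_ldistrib)
  obtain j where "v $ j \<noteq> 0"
    using \<open>v \<noteq> 0\<close> by (auto simp: vec_eq_iff)
  then have "X $ j \<noteq> Y $ j"
    using \<open>u \<noteq> 0\<close> by (auto simp: X_def Y_def)
  then have "Y \<noteq> X"
    by auto
  moreover have "row_support X \<subseteq> I"
    by (auto simp: row_support_def row_def X_def vec_eq_iff split: if_splits)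
  ultimately have "row_norm_sum N X < row_norm_sum N Y"
    using rec feas by (auto simp: uniform_recovery_def unique_minimizer_iff)
  then show ?thesis
    using \<open>N u > 0\<close> by (simp add: X Y)
qed

lemma sum_l1_norm_row: "(\<Sum>j\<in>J. l1_norm (row j V)) = (\<Sum>k\<in>UNIV. \<Sum>j\<in>J. \<bar>column k V $ j\<bar>)"
  unfolding l1_norm_def row_def column_def
  by (subst sum.swap) simp

lemma l11_null_space_property:
  fixes A :: "real ^ 'n ^ 'm" and V :: "real ^ 'r ^ 'n"
  assumes nsp: "\<And>v. A *v v = 0 \<Longrightarrow> v \<noteq> 0 \<Longrightarrow> (\<Sum>j\<in>I. \<bar>v $ j\<bar>) < (\<Sum>j\<in>- I. \<bar>v $ j\<bar>)"
    and ker: "A ** V = 0" and "V \<noteq> 0"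
  shows "(\<Sum>j\<in>I. l1_norm (row j V)) < (\<Sum>j\<in>- I. l1_norm (row j V))"
proof -
  have col: "A *v column k V = 0" for k
    using ker by (simp add: vec_eq_iff matrix_matrix_mult_def matrix_vector_mult_def column_def)
  obtain k where k: "column k V \<noteq> 0"
    using \<open>V \<noteq> 0\<close> by (auto simp: vec_eq_iff column_def)
  \<comment> \<open>Zero columns give equality, so only the weak inequality holds for every column;
    the nonzero column \<open>k\<close> makes the total strict.\<close>
  have "(\<Sum>j\<in>I. \<bar>column l V $ j\<bar>) \<le> (\<Sum>j\<in>- I. \<bar>column l V $ j\<bar>)" for l
    using nsp[OF col[of l]] by (cases "column l V = 0") auto
  then show ?thesis
    unfolding sum_l1_norm_row
    using nsp[OF col k] by (intro sum_strict_mono_ex1) auto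
qed

lemma l1_norm_diff_triangle: "l1_norm x \<le> l1_norm y + l1_norm (y - x)"
  unfolding l1_norm_def sum.distrib[symmetric] by (intro sum_mono) auto

theorem theorem3p2:
  fixes A :: "real ^ 'n ^ 'm" and I :: "'n set" and N :: "real ^ 'r \<Rightarrow> real"
  assumes "is_norm N"
    and "uniform_recovery (row_norm_sum N) A I"
  shows "uniform_recovery (l11_norm :: real ^ 'r ^ 'n \<Rightarrow> real) A I"
proof -
  have "l11_norm X < l11_norm Y"
    if supp: "row_support X \<subseteq> I" and feas: "A ** Y = A ** X" and "Y \<noteq> X"
    for X Y :: "real ^ 'r ^ 'n"
  proof -
    have zero: "row j X = 0" if "j \<in> - I" for j
      using supp that by (auto simp: row_support_def)
    have diff: "row j (Y - X) = row j Y - row j X" for j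
      by (simp add: row_def vec_eq_iff)
    have "l11_norm X = (\<Sum>j\<in>I. l1_norm (row j X))"
      unfolding l11_norm_def row_norm_sum_def sum_UNIV_split[of _ I]
      by (simp add: zero l1_norm_def)
    also have "\<dots> \<le> (\<Sum>j\<in>I. l1_norm (row j Y)) + (\<Sum>j\<in>I. l1_norm (row j (Y - X)))"
      unfolding sum.distrib[symmetric] diff by (intro sum_mono l1_norm_diff_triangle)
    \<comment> \<open>The null space property for \<open>Y - X\<close> moves the error term from
      \<open>I\<close> to its complement, where \<open>X\<close> vanishes and the rows of
      \<open>Y - X\<close> are those of \<open>Y\<close>.\<close>
    also have "\<dots> < (\<Sum>j\<in>I. l1_norm (row j Y)) + (\<Sum>j\<in>- I. l1_norm (row j (Y - X)))"
      using feas \<open>Y \<noteq> X\<close>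
      by (intro add_strict_left_mono l11_null_space_property[of A]
          scalar_null_space_property[OF assms]) (auto simp: matrix_diff_ldistrib)
    also have "\<dots> = l11_norm Y"
      unfolding l11_norm_def row_norm_sum_def sum_UNIV_split[of _ I] by (simp add: diff zero)
    finally show ?thesis .
  qed
  then show ?thesis
    by (auto simp: uniform_recovery_def unique_minimizer_iff)
qed

end
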